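(* For every integer $n\ge 1$, $$|\mathcal{S}_n(21;\,3\to 3)| = d_n + \sum_{m=1}^{n}\sum_{k=0}^{n-m}\binom{n-m}{k}\binom{m+k-1}{n-m}\, d_k,$$ where $d_j$ denotes the $j$-th derangement number.
   Context: $[n]=\{1,\dots,n\}$, and $\mathcal{S}_n$ is the set of permutations $\pi=\pi_1\pi_2\cdots\pi_n$ of $[n]$ in one-line notation. The permutation $\hat\pi$: for $\pi\in\mathcal{S}_n$, $\hat\pi\in\mathcal{S}_n$ is the permutation whose cycle form is obtained from the word $\pi_1\cdots\pi_n$ by inserting a left parenthesis before each left-to-right maximum (an entry larger than all entries to its left) and a right parenthesis immediately before the next left-to-right maximum, or at the end of the word. A cycle $(c_1,c_2,\dots,c_s)$ means $c_1\mapsto c_2\mapsto\cdots\mapsto c_s\mapsto c_1$. Example: if $\pi=2537164$ then $\hat\pi=(2)(53)(7164)$. Arrow patterns: an arrow pattern of size $k$ is a pair $(\nu;H)$ where $\nu=\nu_1\cdots\nu_m$ is a word of distinct positive integers, $H$ is a collection of arrows $b_i\to c_i$, and the set of all integers appearing in $\nu$ or $H$ is $[k]$. A permutation $\pi\in\mathcal{S}_n$ contains $(\nu;H)$ if there are a set $X=\{x_1<x_2<\cdots<x_k\}\subseteq[n]$ and indices $t_1<\cdots<t_m$ such that $\pi_{t_1}\pi_{t_2}\cdots\pi_{t_m}=x_{\nu_1}x_{\nu_2}\cdots x_{\nu_m}$ and $\hat\pi(x_{b_i})=x_{c_i}$ for every arrow $b_i\to c_i$ in $H$. Otherwise $\pi$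 avoids $(\nu;H)$. $\mathcal{S}_n(\nu;H)$ is the set of permutations in $\mathcal{S}_n$ avoiding $(\nu;H)$. The derangement number $d_j$ is the number of permutations of $[j]$ without fixed points ($d_0=1$, $d_1=0$). Binomial coefficients $\binom{a}{b}$ with $0\le a<b$ are $0$. *)

theory Defs
  imports "HOL-Combinatorics.Combinatorics"
begin

text \<open>
  A permutation of \<open>[n]\<close> in one-line notation is a word in
  \<^term>\<open>permutations_of_set {1..n}\<close>.  List positions start at 0, so the entry
  \<open>\<pi>\<^sub>t\<close> is \<open>p ! (t - 1)\<close>.
\<close>

text \<open>
  The words between the parentheses.  The first entry \<open>x\<close> of a block is larger than all
  entries to its left, so the next left-to-right maximum is the first later entry
  exceeding \<open>x\<close>.
\<close>

function ltr_blocks :: "nat list \<Rightarrow> nat list list" where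
  "ltr_blocks [] = []"
| "ltr_blocks (x # xs) =
     (x # takeWhile (\<lambda>y. y \<le> x) xs) # ltr_blocks (dropWhile (\<lambda>y. y \<le> x) xs)"
  by pat_completeness auto
termination
  by (relation "measure length") (auto simp: length_dropWhile_le less_Suc_eq_le)

lemma concat_ltr_blocks: "concat (ltr_blocks p) = p"
  by (induction p rule: ltr_blocks.induct) auto

lemma Nil_notin_ltr_blocks: "[] \<notin> set (ltr_blocks p)"
  by (induction p rule: ltr_blocks.induct) auto

lemma hd_ltr_blocks:
  "hd ` set (ltr_blocks p) = {p ! i | i. i < length p \<and> (\<forall>j<i. p ! j < p ! i)}"
proof -
  have "hd ` set (ltr_blocks p) = {y. \<exists>us vs. p = us @ y # vs \<and> (\<forall>u\<in>set us. u < y)}"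
  proof (induction p rule: ltr_blocks.induct)
    case (2 x xs)
    define T D where "T = takeWhile (\<lambda>y. y \<le> x) xs" and "D = dropWhile (\<lambda>y. y \<le> x) xs"
    have xs: "xs = T @ D" by (simp add: T_def D_def)
    have T: "\<forall>u\<in>set T. u \<le> x" by (auto simp: T_def dest: set_takeWhileD)
    have D: "D = [] \<or> hd D > x"
      by (metis D_def hd_dropWhile not_le)
    have "(\<exists>us vs. x # xs = us @ y # vs \<and> (\<forall>u\<in>set us. u < y)) \<longleftrightarrow>
          y = x \<or> (\<exists>us vs. D = us @ y # vs \<and> (\<forall>u\<in>set us. u < y))" for y
    proof
      assume "\<exists>us vs. x # xs = us @ y # vs \<and> (\<forall>u\<in>set us. u < y)"
      then obtain us vs where u: "x # xs = us @ y # vs" "\<forall>u\<in>set us. u < y" by blast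
      show "y = x \<or> (\<exists>us vs. D = us @ y # vs \<and> (\<forall>u\<in>set us. u < y))"
      proof (cases us)
        case (Cons a us')
        with u have "x < y" "T @ D = us' @ y # vs" "\<forall>u\<in>set us'. u < y" using xs by auto
        moreover have "y \<notin> set T" using T \<open>x < y\<close> by auto
        ultimately obtain w where "us' = T @ w" "D = w @ y # vs"
          by (auto simp: append_eq_append_conv2 append_eq_Cons_conv Cons_eq_append_conv)
        with \<open>\<forall>u\<in>set us'. u < y\<close> show ?thesis by auto
      qed (use u in auto)
    next
      assume "y = x \<or> (\<exists>us vs. D = us @ y # vs \<and> (\<forall>u\<in>set us. u < y))"
      then show "\<exists>us vs. x # xs = us @ y # vs \<and> (\<forall>u\<in>set us. u < y)"
      proof
        assume "\<exists>us vs. D = us @ y # vs \<and> (\<forall>u\<in>set us. u < y)"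
        then obtain us vs where u: "D = us @ y # vs" "\<forall>u\<in>set us. u < y" by blast
        have "x < y" using D u by (cases us) force+
        then have "x # xs = (x # T @ us) @ y # vs \<and> (\<forall>u\<in>set (x # T @ us). u < y)"
          using u T xs by force
        then show ?thesis by blast
      qed (intro exI[of _ "[]"] exI[of _ xs], simp)
    qed
    with 2 show ?case by (auto simp: D_def)
  qed auto
  also have "\<dots> = {p ! i | i. i < length p \<and> (\<forall>j<i. p ! j < p ! i)}"
  proof (intro set_eqI iffI; clarsimp)
    fix y us vs assume "\<forall>u\<in>set us. u < y"
    then show "\<exists>i. y = (us @ y # vs) ! i \<and> i < Suc (length us + length vs) \<and>
        (\<forall>j<i. (us @ y # vs) ! j < (us @ y # vs) ! i)"
      by (intro exI[of _ "length us"]) (auto simp: nth_append)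
  next
    fix i assume "i < length p" "\<forall>j<i. p ! j < p ! i"
    then show "\<exists>us. (\<exists>vs. p = us @ p ! i # vs) \<and> (\<forall>u\<in>set us. u < p ! i)"
      by (intro exI[of _ "take i p"]) (use id_take_nth_drop in \<open>force simp: in_set_conv_nth\<close>)
  qed
  finally show ?thesis .
qed

definition hat :: "nat list \<Rightarrow> nat \<Rightarrow> nat" where
  "hat p = foldr (\<circ>) (map cycle_of_list (ltr_blocks p)) id"

lemma hat_example:
  "ltr_blocks [2,5,3,7,1,6,4] = [[2], [5,3], [7,1,6,4]]"
  "map (hat [2,5,3,7,1,6,4]) [2, 5,3, 7,1,6,4] = [2, 3,5, 1,6,4,7]"
  by (simp_all add: hat_def transpose_def)

type_synonym arrow_pattern = "nat list \<times> (nat \<times> nat) set"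

definition pattern_letters :: "arrow_pattern \<Rightarrow> nat set" where
  "pattern_letters P = set (fst P) \<union> fst ` snd P \<union> snd ` snd P"

definition is_arrow_pattern :: "nat \<Rightarrow> arrow_pattern \<Rightarrow> bool" where
  "is_arrow_pattern k P \<longleftrightarrow> distinct (fst P) \<and> pattern_letters P = {1..k}"

text \<open>
  The set \<open>X = {x\<^sub>1 < \<dots> < x\<^sub>k}\<close> is given by its increasing enumeration \<open>x\<close> on
  \<open>{1..k}\<close>, where \<open>k\<close> is the size of the pattern; positions \<open>t\<close> are counted from 0.
\<close>

definition contains_arrow_pattern :: "nat list \<Rightarrow> arrow_pattern \<Rightarrow> bool" where
  "contains_arrow_pattern p P \<longleftrightarrow>
     (let nu = fst P; H = snd P; k = card (pattern_letters P) in
      \<exists>x t :: nat \<Rightarrow> nat.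
        strict_mono_on {1..k} x \<and> x ` {1..k} \<subseteq> {1..length p} \<and>
        strict_mono_on {..<length nu} t \<and> t ` {..<length nu} \<subseteq> {..<length p} \<and>
        (\<forall>j<length nu. p ! t j = x (nu ! j)) \<and>
        (\<forall>(b, c)\<in>H. hat p (x b) = x c))"

definition avoiders :: "nat \<Rightarrow> arrow_pattern \<Rightarrow> nat list set" where
  "avoiders n P = {p \<in> permutations_of_set {1..n}. \<not> contains_arrow_pattern p P}"

lemma is_arrow_pattern_21_3_3: "is_arrow_pattern 3 ([2, 1], {(3, 3)})"
  by (auto simp: is_arrow_pattern_def pattern_letters_def)

definition derangement_number :: "nat \<Rightarrow> nat" where
  "derangement_number j = card {f. f permutes {1..j} \<and> (\<forall>i\<in>{1..j}. f i \<noteq> i)}"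

end

theory Submission
  imports Defs
begin

text \<open>
  A word \<open>\<pi>\<close> avoids the pattern iff its entries below the largest fixed point \<open>m\<close> of
  \<^term>\<open>hat \<pi>\<close> are increasing, so only that fixed point matters.  If there is none, the fundamental
  bijection \<^const>\<open>hat\<close> yields the derangements.  Otherwise \<open>m\<close> stands just before the first larger
  entry, so it can be deleted without losing information; what remains is a shuffle of
  \<open>1, \<dots>, m - 1\<close> with a word \<open>\<sigma>\<close> on \<open>{m+1..n}\<close>.  No fixed point above \<open>m\<close> survives iff in the
  shuffle every fixed point of \<^term>\<open>hat \<sigma>\<close> is immediately followed by a small entry.  If \<open>k\<close> letters
  of \<open>\<sigma>\<close> are not fixed there are \<open>binomial (m + k - 1) (n - m)\<close> such shuffles, and by the
  fundamental bijection \<open>binomial (n - m) k * d\<^sub>k\<close> words \<open>\<sigma>\<close>.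
\<close>

section \<open>The fundamental bijection\<close>

text \<open>An entry exceeding everything before it closes the current block and opens a new one, so
  the block decomposition can be cut there.\<close>

lemma ltr_blocks_append:
  assumes "\<forall>z\<in>set us. z < y"
  shows "ltr_blocks (us @ y # vs) = ltr_blocks us @ ltr_blocks (y # vs)"
  using assms
proof (induction us rule: ltr_blocks.induct)
  case (2 x xs)
  have "takeWhile (\<lambda>z. z \<le> x) (xs @ y # vs) = takeWhile (\<lambda>z. z \<le> x) xs"
    using 2(2) by (induction xs) auto
  moreover have "dropWhile (\<lambda>z. z \<le> x) (xs @ y # vs) = dropWhile (\<lambda>z. z \<le> x) xs @ y # vs"
    using 2(2) by (induction xs) auto
  moreover have "\<forall>z\<in>set (dropWhile (\<lambda>z. z \<le> x) xs). z < y"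
    using 2(2) by (auto dest: set_dropWhileD)
  ultimately show ?case using 2(1) by simp
qed simp

lemma hat_Nil [simp]: "hat [] = id"
  by (simp add: hat_def)

lemma hat_Cons:
  "hat (x # xs) = cycle_of_list (x # takeWhile (\<lambda>y. y \<le> x) xs) \<circ> hat (dropWhile (\<lambda>y. y \<le> x) xs)"
  by (simp add: hat_def)

lemma foldr_comp_append: "foldr (\<circ>) (fs @ gs) id = foldr (\<circ>) fs id \<circ> foldr (\<circ>) gs id"
  by (induction fs) (auto simp: comp_assoc)

lemma hat_append:
  assumes "\<forall>z\<in>set us. z < y"
  shows "hat (us @ y # vs) = hat us \<circ> hat (y # vs)"
  by (simp only: hat_def ltr_blocks_append[OF assms] map_append foldr_comp_append)

lemma hat_append_Max:
  assumes "\<forall>z\<in>set us. z < y" "\<forall>z\<in>set vs. z \<le> y"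
  shows "hat (us @ y # vs) = hat us \<circ> cycle_of_list (y # vs)"
proof -
  have "takeWhile (\<lambda>z. z \<le> y) vs = vs" "dropWhile (\<lambda>z. z \<le> y) vs = []"
    using assms(2) by (auto simp: takeWhile_eq_all_conv dropWhile_eq_Nil_conv)
  then show ?thesis
    unfolding hat_append[OF assms(1)] hat_Cons by (simp only: hat_Nil comp_id)
qed

lemma hat_permutes: "hat p permutes set p"
proof (induction p rule: ltr_blocks.induct)
  case (2 x xs)
  let ?T = "takeWhile (\<lambda>y. y \<le> x) xs" and ?D = "dropWhile (\<lambda>y. y \<le> x) xs"
  have "set (x # xs) = set (x # ?T) \<union> set ?D"
    by (metis append_Cons set_append takeWhile_dropWhile_id)
  moreover have "cycle_of_list (x # ?T) permutes (set (x # ?T) \<union> set ?D)"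
    by (rule permutes_subset[OF cycle_permutes]) auto
  moreover have "hat ?D permutes (set (x # ?T) \<union> set ?D)"
    by (rule permutes_subset[OF 2]) auto
  ultimately show ?case
    unfolding hat_Cons by (metis permutes_compose)
qed (simp add: permutes_id id_def)

lemma map_cycle_of_list:
  assumes "distinct (x # xs)"
  shows "map (cycle_of_list (x # xs)) (x # xs) = xs @ [x]"
  using cyclic_rotation[OF assms, of 1] by simp

text \<open>Iterating \<open>f\<close> from \<open>a\<close> spells the word letter by letter, and
  the first value \<open>n\<close> marks its end. The start \<open>a\<close> is kept apart from
  \<open>n\<close> so that the induction can advance it.\<close>

lemma eq_if_successors_eq:
  assumes "map f (a # v) = v @ [n]" "map f (a # w) = w @ [n]" "n \<notin> set v" "n \<notin> set w"
  shows "v = w"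
  using assms
proof (induction v arbitrary: a w)
  case Nil
  then show ?case by (cases w) auto
next
  case (Cons b v)
  then obtain w' where "w = b # w'" by (cases w) auto
  with Cons show ?case by auto
qed

text \<open>The last block begins with the maximum \<open>n\<close>, and following
  \<open>hat p\<close> from \<open>n\<close> reads it off. Cancelling that cycle leaves
  \<open>hat\<close> of the shorter prefix, to which induction applies.\<close>

lemma inj_on_hat: "inj_on hat (permutations_of_set A)"
proof (cases "finite A")
  case True
  have "p = q" if "hat p = hat q" "set p = set q" "distinct p" "distinct q" for p q
    using that
  proof (induction "length p" arbitrary: p q rule: less_induct)
    case less
    show ?case
    proof (cases "set p = {}")
      case False
      define n where "n = Max (set p)"
      have n: "n \<in> set p" "\<forall>z\<in>set p. z \<le> n"
        using False by (auto simp: n_def)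
      from n(1) obtain u v where p: "p = u @ n # v" by (meson split_list)
      from n(1) less(3) obtain u' v' where q: "q = u' @ n # v'" by (metis split_list)
      have dp: "n \<notin> set u" "n \<notin> set v" "distinct u" "distinct v" "set u \<inter> set v = {}"
        using less(4) by (auto simp: p)
      have dq: "n \<notin> set u'" "n \<notin> set v'" "distinct u'" "distinct v'" "set u' \<inter> set v' = {}"
        using less(5) by (auto simp: q)
      have u: "\<forall>z\<in>set u. z < n" "\<forall>z\<in>set v. z \<le> n"
        using n(2) dp by (auto simp: p order_less_le)
      have u': "\<forall>z\<in>set u'. z < n" "\<forall>z\<in>set v'. z \<le> n"
        using n(2) dq unfolding less(3) by (auto simp: q order_less_le)
      have hp: "hat p = hat u \<circ> cycle_of_list (n # v)"
        unfolding p by (rule hat_append_Max[OF u])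
      have hq: "hat q = hat u' \<circ> cycle_of_list (n # v')"
        unfolding q by (rule hat_append_Max[OF u'])
      \<comment> \<open>On the letters of the last block only its own cycle acts, since
        \<open>hat u\<close> moves nothing outside \<open>u\<close>.\<close>
      have "map (hat p) (n # v) = map (hat u) (map (cycle_of_list (n # v)) (n # v))"
        by (simp add: hp del: cycle_of_list.simps)
      also have "\<dots> = map (hat u) (v @ [n])"
        using dp by (subst map_cycle_of_list) auto
      also have "\<dots> = v @ [n]"
        using dp by (intro map_idI permutes_not_in[OF hat_permutes]) auto
      finally have a: "map (hat p) (n # v) = v @ [n]" .
      have "map (hat q) (n # v') = map (hat u') (map (cycle_of_list (n # v')) (n # v'))"
        by (simp add: hq del: cycle_of_list.simps)
      also have "\<dots> = map (hat u') (v' @ [n])"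
        using dq by (subst map_cycle_of_list) auto
      also have "\<dots> = v' @ [n]"
        using dq by (intro map_idI permutes_not_in[OF hat_permutes]) auto
      finally have b: "map (hat p) (n # v') = v' @ [n]" by (simp only: less(2))
      have v: "v = v'" by (rule eq_if_successors_eq[OF a b dp(2) dq(2)])
      let ?c = "cycle_of_list (n # v)"
      \<comment> \<open>Surjectivity of the common cycle lets it be cancelled on the right of both
        compositions.\<close>
      have "surj ?c" by (rule permutes_surj[OF cycle_permutes])
      have "hat u z = hat u' z" for z
      proof -
        obtain w where "z = ?c w" using \<open>surj ?c\<close> by (rule surjE)
        moreover have "(hat u \<circ> ?c) w = (hat u' \<circ> ?c) w"
          using less(2) unfolding hp hq v by (rule fun_cong)
        ultimately show ?thesis by (simp only: comp_apply)
      qed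
      then have "hat u = hat u'" by (rule ext)
      moreover have "set u = set u'"
        using less(3) dp(1,2,5) dq(1,2,5) by (auto simp: p q v)
      ultimately have "u = u'"
        using less(1)[of u u'] dp(3) dq(3) by (simp add: p)
      then show ?thesis by (simp add: p q v)
    qed (use less(3) in simp)
  qed
  then show ?thesis by (auto simp: inj_on_def permutations_of_set_def)
qed (simp add: permutations_of_set_infinite)

text \<open>Both sides have \<open>fact (card A)\<close> elements, so injectivity suffices and no
  inverse has to be constructed.\<close>

lemma bij_betw_hat:
  assumes "finite A"
  shows "bij_betw hat (permutations_of_set A) {f. f permutes A}"
proof -
  have "hat ` permutations_of_set A \<subseteq> {f. f permutes A}"
    using hat_permutes by (auto simp: permutations_of_set_def)
  moreover have "card (hat ` permutations_of_set A) = card {f. f permutes A}"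
    using assms by (simp add: card_image[OF inj_on_hat] card_permutations)
  ultimately have "hat ` permutations_of_set A = {f. f permutes A}"
    using assms by (intro card_subset_eq finite_permutations)
  with inj_on_hat show ?thesis by (simp add: bij_betw_def)
qed

section \<open>Fixed points of \<open>hat\<close> as blocks of length one\<close>

definition hat_fixed :: "nat list \<Rightarrow> nat set" where
  "hat_fixed p = {y \<in> set p. hat p y = y}"

lemma hat_fixed_subset: "hat_fixed p \<subseteq> set p"
  by (auto simp: hat_fixed_def)

text \<open>The hypotheses make \<open>[y]\<close> a block by itself, which contributes the
  identity; the remaining blocks do not contain \<open>y\<close>.\<close>

lemma hat_fixedI:
  assumes "distinct (us @ y # vs)" "\<forall>z\<in>set us. z < y" "vs = [] \<or> y < hd vs"
  shows "y \<in> hat_fixed (us @ y # vs)"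
proof -
  have "takeWhile (\<lambda>z. z \<le> y) vs = []" "dropWhile (\<lambda>z. z \<le> y) vs = vs"
    using assms(3) by (cases vs; simp)+
  then have "hat (us @ y # vs) = hat us \<circ> hat vs"
    by (simp add: hat_append[OF assms(2)] hat_Cons)
  with assms(1) show ?thesis
    by (simp add: hat_fixed_def permutes_not_in[OF hat_permutes])
qed

text \<open>In a block of length at least two with distinct entries, every entry is sent to a
  different one. A fixed point is therefore a whole block: a left-to-right maximum followed by a
  larger entry or by nothing.\<close>

lemma hat_fixedE:
  assumes "distinct p" "y \<in> hat_fixed p"
  obtains us vs where "p = us @ y # vs" "\<forall>z\<in>set us. z < y" "vs = [] \<or> y < hd vs"
proof -
  have "\<exists>us vs. p = us @ y # vs \<and> (\<forall>z\<in>set us. z < y) \<and> (vs = [] \<or> y < hd vs)"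
    using assms
  proof (induction p rule: ltr_blocks.induct)
    case (2 x xs)
    define T D where "T = takeWhile (\<lambda>y. y \<le> x) xs" and "D = dropWhile (\<lambda>y. y \<le> x) xs"
    have xs: "xs = T @ D" by (simp add: T_def D_def)
    have T: "\<forall>u\<in>set T. u \<le> x" by (auto simp: T_def dest: set_takeWhileD)
    have D: "D = [] \<or> x < hd D"
      by (metis D_def hd_dropWhile not_le)
    have hat: "hat (x # xs) = cycle_of_list (x # T) \<circ> hat D"
      by (simp add: hat_Cons T_def D_def)
    have dist: "distinct (x # T @ D)" using 2(2) xs by simp
    have y: "hat (x # xs) y = y" "y \<in> set (x # T @ D)"
      using 2(3) xs by (auto simp: hat_fixed_def)
    show ?case
    proof (cases "y \<in> set D")
      case True
      \<comment> \<open>The later blocks keep \<open>y\<close> inside \<open>D\<close>, where the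
        first cycle acts trivially, so \<open>y\<close> is already fixed by
        \<open>hat D\<close>.\<close>
      have "hat D y \<in> set D"
        using True permutes_in_image[OF hat_permutes] by blast
      then have "hat D y \<notin> set (x # T)" using dist by auto
      then have "hat D y = y"
        using y(1) id_outside_supp unfolding hat comp_apply by metis
      then obtain u v where uv: "D = u @ y # v" "\<forall>z\<in>set u. z < y" "v = [] \<or> y < hd v"
        using 2(1) True dist unfolding D_def hat_fixed_def by auto
      have "x < y" using D uv by (cases u) force+
      with uv T have "x # xs = (x # T @ u) @ y # v \<and> (\<forall>z\<in>set (x # T @ u). z < y)"
        by (auto simp: xs)
      with uv show ?thesis by blast
    next
      case False
      then have yT: "y \<in> set (x # T)" using y(2) by auto
      have "cycle_of_list (x # T) y = y"
        using y(1) permutes_not_in[OF hat_permutes False] unfolding hat comp_apply by simp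
      moreover from yT obtain i where i: "i < length (x # T)" "(x # T) ! i = y"
        by (metis in_set_conv_nth)
      moreover have "cycle_of_list (x # T) ((x # T) ! i) = (T @ [x]) ! i"
        using i dist map_cycle_of_list[of x T]
        by (metis distinct.simps(2) distinct_append nth_map append_Cons)
      ultimately have "(x # T) ! i = (T @ [x]) ! i" by simp
      \<comment> \<open>A word with at least two distinct letters agrees nowhere with its rotation
        by one place.\<close>
      have "T = []"
      proof (rule ccontr)
        assume "T \<noteq> []"
        show False
        proof (cases "i = length T")
          case True
          then have "(T @ [x]) ! i = x" by simp
          moreover have "(x # T) ! i \<in> set T"
            using True \<open>T \<noteq> []\<close> by (cases i) auto
          ultimately show False using dist \<open>(x # T) ! i = (T @ [x]) ! i\<close> by auto
        next
          case False
          then have "(T @ [x]) ! i = (x # T) ! Suc i" "Suc i < length (x # T)"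
            using i by (auto simp: nth_append)
          with \<open>(x # T) ! i = (T @ [x]) ! i\<close> show False
            using dist by (metis append_Cons distinct_append n_not_Suc_n nth_eq_iff_index_eq i(1))
        qed
      qed
      with yT D xs have "x # xs = [] @ y # D \<and> (D = [] \<or> y < hd D)" by auto
      then show ?thesis by (intro exI[of _ "[]"] exI[of _ D]) auto
    qed
  qed (simp add: hat_fixed_def)
  with that show ?thesis by blast
qed

section \<open>Counting words by the fixed points of \<open>hat\<close>\<close>

lemma card_derangements:
  assumes "finite K"
  shows "card {f. f permutes K \<and> (\<forall>i\<in>K. f i \<noteq> i)} = derangement_number (card K)"
proof -
  obtain h where h: "bij_betw h {1..card K} K"
    using ex_bij_betw_nat_finite_1[OF assms] by blast
  \<comment> \<open>Conjugation by \<open>h\<close>, extended by the identity outside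
    \<open>K\<close>; it matches fixed points in \<open>{1..card K}\<close> with fixed points in
    \<open>K\<close>.\<close>
  let ?c = "\<lambda>\<pi> x. if x \<in> K then h (\<pi> (inv_into {1..card K} h x)) else x"
  let ?D = "{f. f permutes {1..card K} \<and> (\<forall>i\<in>{1..card K}. f i \<noteq> i)}"
  have b: "bij_betw ?c {\<pi>. \<pi> permutes {1..card K}} {\<pi>. \<pi> permutes K}"
    by (rule bij_betw_permutations[OF h])
  have "(\<forall>i\<in>K. ?c f i \<noteq> i) \<longleftrightarrow> (\<forall>i\<in>{1..card K}. f i \<noteq> i)" if f: "f permutes {1..card K}" for f
  proof -
    have "(\<forall>i\<in>K. ?c f i \<noteq> i) \<longleftrightarrow> (\<forall>j\<in>{1..card K}. ?c f (h j) \<noteq> h j)"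
      using h by (metis (no_types, lifting) bij_betw_imp_surj_on image_iff)
    also have "\<dots> \<longleftrightarrow> (\<forall>j\<in>{1..card K}. h (f j) \<noteq> h j)"
      using h by (intro ball_cong) (auto simp: bij_betw_inv_into_left bij_betw_apply)
    also have "\<dots> \<longleftrightarrow> (\<forall>j\<in>{1..card K}. f j \<noteq> j)"
      using h permutes_in_image[OF f] by (intro ball_cong) (auto simp: bij_betw_def inj_on_eq_iff)
    finally show ?thesis .
  qed
  then have "bij_betw ?c {f \<in> {f. f permutes {1..card K}}. \<forall>i\<in>{1..card K}. f i \<noteq> i}
      {f \<in> {f. f permutes K}. \<forall>i\<in>K. f i \<noteq> i}"
    by (intro bij_betw_Collect[OF b]) blast
  then have "bij_betw ?c ?D {f. f permutes K \<and> (\<forall>i\<in>K. f i \<noteq> i)}"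
    unfolding mem_Collect_eq .
  from bij_betw_same_card[OF this] show ?thesis
    by (simp only: derangement_number_def)
qed

lemma sum_Pow_card:
  fixes g :: "nat \<Rightarrow> nat"
  assumes "finite A"
  shows "(\<Sum>K\<in>Pow A. g (card K)) = (\<Sum>k = 0..card A. (card A choose k) * g k)"
proof -
  have "(\<Sum>K\<in>Pow A. g (card K)) = (\<Sum>k = 0..card A. \<Sum>K\<in>{K \<in> Pow A. card K = k}. g (card K))"
    using assms by (intro sum.group[symmetric]) (auto intro: card_mono)
  also have "\<dots> = (\<Sum>k = 0..card A. (card A choose k) * g k)"
    using assms by (intro sum.cong) (simp_all add: n_subsets)
  finally show ?thesis .
qed

text \<open>After transport along \<open>hat\<close>, permutations are grouped by the set
  \<open>K\<close> of points they move; those with moved set \<open>K\<close> are the derangements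
  of \<open>K\<close>. The weight \<open>g\<close> will be a number of shuffles.\<close>

lemma sum_permutations_of_set_hat_fixed:
  fixes g :: "nat \<Rightarrow> nat"
  assumes "finite A"
  shows "(\<Sum>p\<in>permutations_of_set A. g (card (A - hat_fixed p))) =
    (\<Sum>k = 0..card A. (card A choose k) * (derangement_number k * g k))"
proof -
  let ?mv = "\<lambda>f. {x \<in> A. f x \<noteq> x}"
  have "(\<Sum>p\<in>permutations_of_set A. g (card (A - hat_fixed p))) =
      (\<Sum>p\<in>permutations_of_set A. g (card (?mv (hat p))))"
    by (intro sum.cong refl arg_cong[of _ _ g] arg_cong[of _ _ card])
      (auto simp: hat_fixed_def permutations_of_set_def)
  also have "\<dots> = (\<Sum>f | f permutes A. g (card (?mv f)))"
    by (rule sum.reindex_bij_betw[OF bij_betw_hat[OF assms]])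
  also have "\<dots> = (\<Sum>K\<in>Pow A. \<Sum>f\<in>{f \<in> {f. f permutes A}. ?mv f = K}. g (card (?mv f)))"
    using assms by (intro sum.group[symmetric]) (auto intro: finite_permutations)
  also have "\<dots> = (\<Sum>K\<in>Pow A. derangement_number (card K) * g (card K))"
  proof (rule sum.cong[OF refl])
    fix K assume "K \<in> Pow A"
    then have "{f \<in> {f. f permutes A}. ?mv f = K} = {f. f permutes K \<and> (\<forall>i\<in>K. f i \<noteq> i)}"
      by (auto intro: permutes_subset permutes_superset) (metis permutes_not_in)+
    moreover have "finite K" using \<open>K \<in> Pow A\<close> assms finite_subset by auto
    ultimately have "card {f \<in> {f. f permutes A}. ?mv f = K} = derangement_number (card K)"
      by (simp only: card_derangements)
    moreover have "(\<Sum>f\<in>{f \<in> {f. f permutes A}. ?mv f = K}. g (card (?mv f))) =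
        (\<Sum>f\<in>{f \<in> {f. f permutes A}. ?mv f = K}. g (card K))"
      by (intro sum.cong) auto
    ultimately show "(\<Sum>f\<in>{f \<in> {f. f permutes A}. ?mv f = K}. g (card (?mv f))) =
        derangement_number (card K) * g (card K)"
      by simp
  qed
  also have "\<dots> = (\<Sum>k = 0..card A. (card A choose k) * (derangement_number k * g k))"
    using sum_Pow_card[OF assms, of "\<lambda>k. derangement_number k * g k"] by simp
  finally show ?thesis .
qed

lemma card_hat_fixed_empty:
  assumes "finite A"
  shows "card {p \<in> permutations_of_set A. hat_fixed p = {}} = derangement_number (card A)"
proof -
  have "card {p \<in> permutations_of_set A. hat_fixed p = {}} =
      card {f \<in> {f. f permutes A}. \<forall>i\<in>A. f i \<noteq> i}"
    by (rule bij_betw_same_card[where f = hat], rule bij_betw_Collect[OF bij_betw_hat[OF assms]])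
      (auto simp: hat_fixed_def permutations_of_set_def)
  then show ?thesis using card_derangements[OF assms] by simp
qed

section \<open>Shuffles in which marked letters are protected\<close>

text \<open>In the application \<open>S\<close> holds the letters below \<open>m\<close> and
  \<open>F\<close> the fixed points of \<open>hat \<sigma>\<close>. A small letter directly after
  such a fixed point joins its block and so destroys it as a fixed point.\<close>

definition protected :: "'a set \<Rightarrow> 'a set \<Rightarrow> 'a list \<Rightarrow> bool" where
  "protected S F l \<longleftrightarrow> (\<forall>us x vs. l = us @ x # vs \<longrightarrow> x \<in> F \<longrightarrow> vs \<noteq> [] \<and> hd vs \<in> S)"

lemma protected_Nil [simp]: "protected S F []"
  by (simp add: protected_def)

lemma protected_Cons [simp]:
  "protected S F (a # l) \<longleftrightarrow> (a \<in> F \<longrightarrow> l \<noteq> [] \<and> hd l \<in> S) \<and> protected S F l"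
  (is "?L \<longleftrightarrow> ?R")
proof
  assume L: ?L
  have "vs \<noteq> [] \<and> hd vs \<in> S" if "l = us @ x # vs" "x \<in> F" for us x vs
    using L that unfolding protected_def by (metis append_Cons)
  moreover have "a \<in> F \<longrightarrow> l \<noteq> [] \<and> hd l \<in> S"
    using L unfolding protected_def by (metis append_Nil)
  ultimately show ?R by (auto simp: protected_def)
qed (auto simp: protected_def Cons_eq_append_conv)

lemma protected_disjoint:
  "set l \<inter> S = {} \<Longrightarrow> protected S F l \<longleftrightarrow> set l \<inter> F = {}"
  by (induction l) (auto simp: hd_in_set dest: hd_in_set)

text \<open>Split by the first letter of the shuffle. If \<open>s\<close> is unmarked, either head
  may come first; if \<open>s\<close> is marked, it must bring \<open>z\<close> along directly
  behind it. Both recurrences are instances of Pascal's rule.\<close>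

lemma card_protected_shuffles:
  assumes "set zs \<subseteq> S" "set \<sigma> \<inter> S = {}" "F \<inter> S = {}"
  shows "card {l \<in> shuffles zs \<sigma>. protected S F l} =
    (length zs + length (filter (\<lambda>x. x \<notin> F) \<sigma>)) choose length \<sigma>"
  using assms(1,2)
proof (induction \<sigma> arbitrary: zs)
  case Nil
  then have "set zs \<inter> F = {}" using assms(3) by auto
  then have "protected S F zs" by (induction zs) auto
  then have "{l. l = zs \<and> protected S F l} = {zs}" by auto
  then show ?case by simp
next
  case (Cons s \<sigma>)
  note outer = Cons.IH and \<sigma> = Cons.prems(2)
  from Cons.prems(1) show ?case
  proof (induction zs)
    case Nil
    \<comment> \<open>Without small letters nothing can protect a marked letter: the only shuffle
      counts iff nothing is marked, and otherwise the binomial vanishes because its top is smaller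
      than its bottom.\<close>
    have "{l \<in> shuffles [] (s # \<sigma>). protected S F l} = (if set (s # \<sigma>) \<inter> F = {} then {s # \<sigma>} else {})"
      using protected_disjoint[OF \<sigma>, of F] by auto
    moreover have "length (filter (\<lambda>x. x \<notin> F) (s # \<sigma>)) = length (s # \<sigma>)" if "set (s # \<sigma>) \<inter> F = {}"
      using that by (metis (mono_tags, lifting) disjoint_iff filter_True)
    moreover have "length (filter (\<lambda>x. x \<notin> F) (s # \<sigma>)) < length (s # \<sigma>)" if "set (s # \<sigma>) \<inter> F \<noteq> {}"
      using that by (metis (mono_tags, lifting) disjoint_iff length_filter_less)
    ultimately show ?case by (auto simp: binomial_eq_0)
  next
    case (Cons z zs)
    have z: "z \<in> S" "z \<notin> F" "set zs \<subseteq> S" "s \<notin> S" "set \<sigma> \<inter> S = {}" "s \<noteq> z"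
      using Cons.prems \<sigma> assms(3) by auto
    let ?C = "\<lambda>zs \<sigma>. {l \<in> shuffles zs \<sigma>. protected S F l}"
    have fin: "finite (?C xs ys)" for xs ys by simp
    \<comment> \<open>The only other possible head is the first letter of \<open>\<sigma>\<close>,
      which is not in \<open>S\<close>.\<close>
    have hd_small: "hd l \<in> S \<longleftrightarrow> (\<exists>l'\<in>shuffles zs \<sigma>. l = z # l')" if "l \<in> shuffles (z # zs) \<sigma>" for l
      using that z by (cases \<sigma>) auto
    have nonempty: "l \<noteq> []" if "l \<in> shuffles (z # zs) \<sigma>" for l
      using that by (cases l) auto
    show ?case
    proof (cases "s \<in> F")
      case False
      have "?C (z # zs) (s # \<sigma>) = (#) z ` ?C zs (s # \<sigma>) \<union> (#) s ` ?C (z # zs) \<sigma>"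
        using False z by auto
      moreover have "card ((#) z ` ?C zs (s # \<sigma>) \<union> (#) s ` ?C (z # zs) \<sigma>) =
          card (?C zs (s # \<sigma>)) + card (?C (z # zs) \<sigma>)"
        using fin z by (subst card_Un_disjoint) (auto simp: card_image)
      ultimately show ?thesis
        using Cons.IH[OF z(3)] outer[OF Cons.prems z(5)] False by simp
    next
      case True
      have "?C (z # zs) (s # \<sigma>) = (#) z ` ?C zs (s # \<sigma>) \<union> (\<lambda>l. s # z # l) ` ?C zs \<sigma>"
      proof -
        have "{l \<in> shuffles (z # zs) \<sigma>. l \<noteq> [] \<and> hd l \<in> S \<and> protected S F l} = (#) z ` ?C zs \<sigma>"
          using hd_small nonempty z by (auto simp: Cons_in_shuffles_iff)
        then have "(#) s ` {l \<in> shuffles (z # zs) \<sigma>. l \<noteq> [] \<and> hd l \<in> S \<and> protected S F l} =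
            (\<lambda>l. s # z # l) ` ?C zs \<sigma>" by (simp add: image_image)
        moreover have "?C (z # zs) (s # \<sigma>) = (#) z ` ?C zs (s # \<sigma>) \<union>
            (#) s ` {l \<in> shuffles (z # zs) \<sigma>. l \<noteq> [] \<and> hd l \<in> S \<and> protected S F l}"
          using True z by auto
        ultimately show ?thesis by simp
      qed
      moreover have "card ((#) z ` ?C zs (s # \<sigma>) \<union> (\<lambda>l. s # z # l) ` ?C zs \<sigma>) =
          card (?C zs (s # \<sigma>)) + card (?C zs \<sigma>)"
        using fin z by (subst card_Un_disjoint) (auto simp: card_image inj_on_def)
      ultimately show ?thesis
        using Cons.IH[OF z(3)] outer[OF z(3) z(5)] True by simp
    qed
  qed
qed


section \<open>Removing the largest fixed point\<close>

text \<open>\<open>P\<close> tells the two words apart, so each can be recovered from a shuffle by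
  filtering.\<close>

lemma shuffles_iff_filter:
  assumes "\<forall>x\<in>set xs. P x" "\<forall>y\<in>set ys. \<not> P y"
  shows "l \<in> shuffles xs ys \<longleftrightarrow> filter P l = xs \<and> filter (\<lambda>x. \<not> P x) l = ys"
proof
  assume l: "l \<in> shuffles xs ys"
  have "filter P l \<in> shuffles (filter P xs) (filter P ys)"
    and "filter (\<lambda>x. \<not> P x) l \<in> shuffles (filter (\<lambda>x. \<not> P x) xs) (filter (\<lambda>x. \<not> P x) ys)"
    using l by (metis filter_shuffles imageI)+
  moreover have "filter P xs = xs" "filter P ys = []"
      "filter (\<lambda>x. \<not> P x) xs = []" "filter (\<lambda>x. \<not> P x) ys = ys"
    using assms by (auto simp: filter_empty_conv)
  ultimately show "filter P l = xs \<and> filter (\<lambda>x. \<not> P x) l = ys" by simp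
qed (use partition_in_shuffles in blast)

text \<open>Entries at most \<open>m\<close> never prevent \<open>x > m\<close> from being a
  left-to-right maximum. They matter only directly after \<open>x\<close>, where such an entry
  extends the block of \<open>x\<close>.\<close>

lemma hat_fixed_filter_greater:
  assumes "distinct p" "x > m" "p = us @ x # vs"
  shows "x \<in> hat_fixed p \<longleftrightarrow> x \<in> hat_fixed (filter (\<lambda>y. y > m) p) \<and> (vs = [] \<or> m < hd vs)"
    (is "_ \<longleftrightarrow> x \<in> hat_fixed ?\<sigma> \<and> _")
proof
  let ?f = "filter (\<lambda>y. y > m)"
  have \<sigma>: "?\<sigma> = ?f us @ x # ?f vs" using assms(2,3) by simp
  have dist: "distinct ?\<sigma>" using assms(1) by simp
  {
    assume "x \<in> hat_fixed p"
    with assms(1) obtain us' vs' where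
      d: "p = us' @ x # vs'" "\<forall>z\<in>set us'. z < x" "vs' = [] \<or> x < hd vs'"
      by (rule hat_fixedE)
    \<comment> \<open>By distinctness \<open>x\<close> occurs once, so the two decompositions around
      it coincide.\<close>
    have "us @ x # vs = us' @ x # vs'" "x \<notin> set us" "x \<notin> set vs"
      using assms(1,3) d(1) by auto
    then have eq: "us' = us" "vs' = vs" by (auto simp: append_Cons_eq_iff)
    then have "?f vs = [] \<or> x < hd (?f vs)" "vs = [] \<or> m < hd vs"
      using d(3) assms(2) by (cases vs; auto)+
    then show "x \<in> hat_fixed ?\<sigma> \<and> (vs = [] \<or> m < hd vs)"
      using dist d(2) eq unfolding \<sigma> by (auto intro!: hat_fixedI)
  next
    assume R: "x \<in> hat_fixed ?\<sigma> \<and> (vs = [] \<or> m < hd vs)"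
    with dist obtain us' vs' where
      d: "?\<sigma> = us' @ x # vs'" "\<forall>z\<in>set us'. z < x" "vs' = [] \<or> x < hd vs'"
      using hat_fixedE by blast
    have "?f us @ x # ?f vs = us' @ x # vs'" "x \<notin> set (?f us)" "x \<notin> set (?f vs)"
      using assms(1,3) d(1) unfolding \<sigma> by auto
    then have eq: "us' = ?f us" "vs' = ?f vs" by (auto simp: append_Cons_eq_iff)
    have "\<forall>z\<in>set us. z < x" using d(2) assms(2) eq by fastforce
    moreover have "vs = [] \<or> x < hd vs" using d(3) R eq by (cases vs) auto
    ultimately show "x \<in> hat_fixed p"
      using assms(1) unfolding assms(3) by (intro hat_fixedI)
  }
qed

text \<open>For a distinct word without \<open>m\<close>, this is the only place where inserting
  \<open>m\<close> makes it a fixed point of \<open>hat\<close>; it is the end of the word if no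
  letter exceeds \<open>m\<close>.\<close>

definition insert_before_greater :: "nat \<Rightarrow> nat list \<Rightarrow> nat list" where
  "insert_before_greater m l = takeWhile (\<lambda>y. y < m) l @ m # dropWhile (\<lambda>y. y < m) l"

lemma inj_insert_before_greater: "inj_on (insert_before_greater m) {l. m \<notin> set l}"
proof (rule inj_on_inverseI[where g = "remove1 m"])
  fix l assume "l \<in> {l. m \<notin> set l}"
  then show "remove1 m (insert_before_greater m l) = l"
    by (auto simp: insert_before_greater_def remove1_append dest: set_takeWhileD)
qed

text \<open>The last condition is avoidance: in a permutation of \<open>{1..n}\<close>, increasing
  entries below \<open>m\<close> can only spell \<open>[1..<m]\<close>.\<close>

definition words_largest_fixed :: "nat \<Rightarrow> nat \<Rightarrow> nat list set" where
  "words_largest_fixed n m = {p \<in> permutations_of_set {1..n}.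
     m \<in> hat_fixed p \<and> (\<forall>x\<in>hat_fixed p. x \<le> m) \<and> filter (\<lambda>y. y < m) p = [1..<m]}"

definition protected_words :: "nat \<Rightarrow> nat list \<Rightarrow> nat list set" where
  "protected_words m \<sigma> = {l \<in> shuffles [1..<m] \<sigma>. protected {..<m} (hat_fixed \<sigma>) l}"

text \<open>Since \<open>\<sigma>\<close> can be read off the shuffle, different
  \<open>\<sigma>\<close> give disjoint sets of words.\<close>

lemma protected_wordsD:
  assumes "l \<in> protected_words m \<sigma>" "set \<sigma> = {Suc m..n}" "1 \<le> m"
  shows "set l = {1..<m} \<union> {Suc m..n}" "filter (\<lambda>y. y < m) l = [1..<m]"
    "filter (\<lambda>y. y > m) l = \<sigma>"
proof -
  have l: "l \<in> shuffles [1..<m] \<sigma>" using assms(1) by (simp add: protected_words_def)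
  then show s: "set l = {1..<m} \<union> {Suc m..n}" using assms(2) by (auto simp: set_shuffles)
  have "l \<in> shuffles [1..<m] \<sigma> \<longleftrightarrow>
      filter (\<lambda>y. y < m) l = [1..<m] \<and> filter (\<lambda>y. \<not> y < m) l = \<sigma>"
    using assms(2) by (intro shuffles_iff_filter) auto
  moreover have "filter (\<lambda>y. \<not> y < m) l = filter (\<lambda>y. y > m) l"
    using s by (intro filter_cong) auto
  ultimately show "filter (\<lambda>y. y < m) l = [1..<m]" "filter (\<lambda>y. y > m) l = \<sigma>"
    using l by auto
qed

text \<open>Deleting and reinserting \<open>m\<close> are mutually inverse. In both directions
  \<open>hat_fixed_filter_greater\<close> translates the absence of fixed points above
  \<open>m\<close> into protection of the fixed points of \<open>hat \<sigma>\<close>.\<close>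

lemma words_largest_fixed_eq:
  assumes "1 \<le> m" "m \<le> n"
  shows "words_largest_fixed n m = insert_before_greater m `
    (\<Union>\<sigma>\<in>permutations_of_set {Suc m..n}. protected_words m \<sigma>)"
proof (intro equalityI subsetI)
  fix p assume "p \<in> words_largest_fixed n m"
  then have p: "set p = {1..n}" "distinct p" "m \<in> hat_fixed p" "\<forall>x\<in>hat_fixed p. x \<le> m"
      "filter (\<lambda>y. y < m) p = [1..<m]"
    by (auto simp: words_largest_fixed_def permutations_of_set_def)
  obtain us vs where d: "p = us @ m # vs" "\<forall>z\<in>set us. z < m" "vs = [] \<or> m < hd vs"
    using p(2,3) by (rule hat_fixedE)
  define \<sigma> where "\<sigma> = filter (\<lambda>y. y > m) p"
  have \<sigma>: "set \<sigma> = {Suc m..n}" "distinct \<sigma>"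
    using p(1,2) by (auto simp: \<sigma>_def)
  \<comment> \<open>The word without \<open>m\<close> first leaves the range below \<open>m\<close>
    exactly where \<open>m\<close> stood, so reinsertion restores \<open>p\<close>.\<close>
  have "takeWhile (\<lambda>y. y < m) (us @ vs) = us" "dropWhile (\<lambda>y. y < m) (us @ vs) = vs"
    using d(2,3) by (cases vs; simp)+
  then have ins: "insert_before_greater m (us @ vs) = p"
    by (simp add: insert_before_greater_def d(1))
  have "filter (\<lambda>y. \<not> y < m) (us @ vs) = filter (\<lambda>y. y > m) (us @ vs)"
    using p(2) d(1) by (intro filter_cong) auto
  then have "us @ vs \<in> shuffles [1..<m] \<sigma>"
    using \<sigma>(1) p(5) unfolding d(1)
    by (subst shuffles_iff_filter[where P = "\<lambda>y. y < m"]) (auto simp: \<sigma>_def d(1))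
  moreover have "protected {..<m} (hat_fixed \<sigma>) (us @ vs)"
    unfolding protected_def
  proof (intro allI impI)
    fix as x bs assume e: "us @ vs = as @ x # bs" "x \<in> hat_fixed \<sigma>"
    then have x: "x > m" using hat_fixed_subset \<sigma>(1) by fastforce
    then have "x \<notin> set us" using d(2) by auto
    with e(1) obtain cs where cs: "vs = cs @ x # bs"
      by (auto simp: append_eq_append_conv2 append_eq_Cons_conv Cons_eq_append_conv)
    \<comment> \<open>As \<open>x\<close> is fixed for \<open>\<sigma>\<close> but not for
      \<open>p\<close>, an entry at most \<open>m\<close> follows it; that entry is not
      \<open>m\<close>, which stands further left.\<close>
    have "x \<notin> hat_fixed p" using x p(4) by auto
    then have "\<not> (bs = [] \<or> m < hd bs)"
      using hat_fixed_filter_greater[OF p(2) x, of "us @ m # cs" bs] e(2) cs d(1)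
      by (auto simp: \<sigma>_def)
    moreover have "hd bs \<noteq> m" if "bs \<noteq> []"
      using p(2) that by (cases bs) (auto simp: d(1) cs)
    ultimately show "bs \<noteq> [] \<and> hd bs \<in> {..<m}" by auto
  qed
  ultimately have "us @ vs \<in> protected_words m \<sigma>" by (simp add: protected_words_def)
  then show "p \<in> insert_before_greater m ` (\<Union>\<sigma>\<in>permutations_of_set {Suc m..n}. protected_words m \<sigma>)"
    using \<sigma> ins by (intro image_eqI[of _ _ "us @ vs"]) (auto intro!: permutations_of_setI)
next
  fix p
  assume "p \<in> insert_before_greater m ` (\<Union>\<sigma>\<in>permutations_of_set {Suc m..n}. protected_words m \<sigma>)"
  then obtain \<sigma> l where \<sigma>: "set \<sigma> = {Suc m..n}" "distinct \<sigma>"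
    and l: "l \<in> protected_words m \<sigma>" and p: "p = insert_before_greater m l"
    by (auto simp: permutations_of_set_def)
  note lD = protected_wordsD[OF l \<sigma>(1) assms(1)]
  have "distinct l"
    using l \<sigma> by (intro distinct_disjoint_shuffles[of "[1..<m]" \<sigma> l]) (auto simp: protected_words_def)
  define us vs where "us = takeWhile (\<lambda>y. y < m) l" and "vs = dropWhile (\<lambda>y. y < m) l"
  have luv: "l = us @ vs" by (simp add: us_def vs_def)
  have puv: "p = us @ m # vs" by (simp add: p us_def vs_def insert_before_greater_def)
  have us: "\<forall>z\<in>set us. z < m" by (auto simp: us_def dest: set_takeWhileD)
  have "m \<notin> set l" using lD(1) by simp
  have "\<not> hd vs < m" if "vs \<noteq> []" using that unfolding vs_def by (rule hd_dropWhile)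
  moreover have "hd vs \<noteq> m" if "vs \<noteq> []"
    using that \<open>m \<notin> set l\<close> hd_in_set[OF that] by (auto simp: luv)
  ultimately have vs: "vs = [] \<or> m < hd vs" using nat_neq_iff by blast
  have dist: "distinct p" using \<open>distinct l\<close> \<open>m \<notin> set l\<close> by (auto simp: luv puv)
  have "set p = insert m (set l)" by (simp add: luv puv)
  also have "\<dots> = {1..n}" using assms by (auto simp: lD(1))
  finally have set: "set p = {1..n}" .
  have "m \<in> hat_fixed p" using dist us vs unfolding puv by (rule hat_fixedI)
  moreover have "x \<le> m" if "x \<in> hat_fixed p" for x
  proof (rule ccontr)
    assume "\<not> x \<le> m"
    then have x: "x > m" by simp
    \<comment> \<open>Everything before \<open>m\<close> is smaller than \<open>m\<close>, so
      \<open>x\<close> stands to its right and has the same successor in \<open>p\<close> as in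
      \<open>l\<close>.\<close>
    have "x \<in> set vs" using that hat_fixed_subset x us by (fastforce simp: puv)
    then obtain as bs where bs: "vs = as @ x # bs" by (meson split_list)
    have "x \<in> hat_fixed (filter (\<lambda>y. y > m) p)" "bs = [] \<or> m < hd bs"
      using hat_fixed_filter_greater[OF dist x, of "us @ m # as" bs] that by (auto simp: puv bs)
    moreover have "filter (\<lambda>y. y > m) p = \<sigma>" using lD(3) by (simp add: luv puv)
    ultimately have "x \<in> hat_fixed \<sigma>" "bs = [] \<or> m < hd bs" by simp_all
    moreover have "l = (us @ as) @ x # bs" by (simp add: luv bs)
    ultimately show False
      using l unfolding protected_words_def protected_def by fastforce
  qed
  moreover have "filter (\<lambda>y. y < m) p = [1..<m]" using lD(2) by (simp add: luv puv)
  ultimately show "p \<in> words_largest_fixed n m"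
    using dist set by (auto simp: words_largest_fixed_def intro: permutations_of_setI)
qed

text \<open>Each \<open>\<sigma>\<close> contributes its number of protected shuffles with the
  \<open>m - 1\<close> small letters. This depends only on how many letters of
  \<open>\<sigma>\<close> are not fixed, so the weighted sum over words applies.\<close>

lemma card_words_largest_fixed:
  assumes "1 \<le> m" "m \<le> n"
  shows "card (words_largest_fixed n m) =
    (\<Sum>k = 0..n - m. ((n - m) choose k) * ((m + k - 1) choose (n - m)) * derangement_number k)"
proof -
  \<comment> \<open>Truncated subtraction is harmless here because \<open>m\<close> is at least
    1.\<close>
  have shift: "m - 1 + k = m + k - 1" for k using assms(1) by simp
  let ?A = "{Suc m..n}"
  let ?U = "\<Union>\<sigma>\<in>permutations_of_set ?A. protected_words m \<sigma>"
  have filt: "filter (\<lambda>y. y > m) l = \<sigma>" and "m \<notin> set l"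
    if "\<sigma> \<in> permutations_of_set ?A" "l \<in> protected_words m \<sigma>" for \<sigma> l
    using protected_wordsD(1,3)[OF that(2) permutations_of_setD(1)[OF that(1)] assms(1)] by simp_all
  then have "?U \<subseteq> {l. m \<notin> set l}" by blast
  then have "card (words_largest_fixed n m) = card ?U"
    unfolding words_largest_fixed_eq[OF assms]
    by (intro card_image inj_on_subset[OF inj_insert_before_greater])
  also have "\<dots> = (\<Sum>\<sigma>\<in>permutations_of_set ?A. card (protected_words m \<sigma>))"
  proof (rule card_UN_disjoint)
    show "\<forall>\<sigma>\<in>permutations_of_set ?A. finite (protected_words m \<sigma>)"
      by (auto simp: protected_words_def)
    show "\<forall>\<sigma>\<in>permutations_of_set ?A. \<forall>\<tau>\<in>permutations_of_set ?A. \<sigma> \<noteq> \<tau> \<longrightarrow>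
        protected_words m \<sigma> \<inter> protected_words m \<tau> = {}"
      using filt by blast
  qed simp
  also have "\<dots> = (\<Sum>\<sigma>\<in>permutations_of_set ?A. (m - 1 + card (?A - hat_fixed \<sigma>)) choose (n - m))"
  proof (rule sum.cong[OF refl])
    fix \<sigma> assume "\<sigma> \<in> permutations_of_set ?A"
    then have \<sigma>: "set \<sigma> = ?A" "distinct \<sigma>" by (auto simp: permutations_of_set_def)
    have len: "length \<sigma> = n - m" using distinct_card[OF \<sigma>(2)] \<sigma>(1) by simp
    let ?\<tau> = "filter (\<lambda>x. x \<notin> hat_fixed \<sigma>) \<sigma>"
    have "set ?\<tau> = ?A - hat_fixed \<sigma>"
      unfolding set_filter \<sigma>(1) by blast
    moreover have "card (set ?\<tau>) = length ?\<tau>"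
      by (rule distinct_card[OF distinct_filter[OF \<sigma>(2)]])
    ultimately have len': "length ?\<tau> = card (?A - hat_fixed \<sigma>)" by (simp only:)
    have "card (protected_words m \<sigma>) =
        (length [1..<m] + length (filter (\<lambda>x. x \<notin> hat_fixed \<sigma>) \<sigma>)) choose length \<sigma>"
      unfolding protected_words_def using \<sigma>(1) hat_fixed_subset[of \<sigma>]
      by (intro card_protected_shuffles) auto
    then show "card (protected_words m \<sigma>) = (m - 1 + card (?A - hat_fixed \<sigma>)) choose (n - m)"
      by (simp add: len len')
  qed
  also have "\<dots> = (\<Sum>k = 0..n - m.
      ((n - m) choose k) * (derangement_number k * ((m - 1 + k) choose (n - m))))"
    using sum_permutations_of_set_hat_fixed[of ?A "\<lambda>k. (m - 1 + k) choose (n - m)"] by simp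
  also have "\<dots> = (\<Sum>k = 0..n - m. ((n - m) choose k) * ((m + k - 1) choose (n - m)) * derangement_number k)"
    unfolding shift by (simp only: mult.assoc mult.commute[of "derangement_number _"])
  finally show ?thesis .
qed

section \<open>The arrow pattern\<close>

lemma sorted_wrt_filter_iff:
  "sorted_wrt R (filter P xs) \<longleftrightarrow> sorted_wrt (\<lambda>x y. P x \<longrightarrow> P y \<longrightarrow> R x y) xs"
  by (induction xs) auto

text \<open>The letter 3 is played by a fixed point \<open>c\<close>, and the letters 2 and 1 by an
  inversion among the entries below \<open>c\<close>.\<close>

lemma contains_21_3_3_iff:
  assumes "p \<in> permutations_of_set {1..n}"
  shows "contains_arrow_pattern p ([2, 1], {(3, 3)}) \<longleftrightarrow>
    (\<exists>c\<in>hat_fixed p. \<not> sorted (filter (\<lambda>y. y < c) p))"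
proof -
  have p: "set p = {1..n}" "distinct p"
    using assms by (rule permutations_of_setD)+
  then have "length p = n" using distinct_card[of p] by simp
  note p = p this
  have letters: "card (pattern_letters ([2, 1], {(3, 3)})) = 3"
    using is_arrow_pattern_21_3_3 by (simp add: is_arrow_pattern_def)
  have unsorted: "\<not> sorted (filter (\<lambda>y. y < c) p) \<longleftrightarrow>
      (\<exists>i j. i < j \<and> j < n \<and> p ! j < p ! i \<and> p ! i < c)" for c
  proof -
    have s: "sorted (filter (\<lambda>y. y < c) p) \<longleftrightarrow>
        (\<forall>i j. i < j \<longrightarrow> j < n \<longrightarrow> p ! i < c \<longrightarrow> p ! j < c \<longrightarrow> p ! i \<le> p ! j)"
      unfolding sorted_wrt_filter_iff unfolding sorted_wrt_iff_nth_less p(3) by (rule refl)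
    have "p ! j < p ! i \<and> p ! i < c \<longleftrightarrow> p ! i < c \<and> p ! j < c \<and> \<not> p ! i \<le> p ! j" for i j
      by linarith
    then show ?thesis unfolding s by blast
  qed
  show ?thesis
  proof
    assume "contains_arrow_pattern p ([2, 1], {(3, 3)})"
    then obtain x t :: "nat \<Rightarrow> nat" where
      x: "strict_mono_on {1..3} x" "x ` {1..3} \<subseteq> {1..n}" and
      t: "strict_mono_on {..<2} t" "t ` {..<2} \<subseteq> {..<n}" and
      e: "\<forall>j<2. p ! t j = x ([2, 1] ! j)" and h: "hat p (x 3) = x 3"
      unfolding contains_arrow_pattern_def Let_def letters p(3) by (auto simp: numeral_2_eq_2)
    have "x 1 < x 2" "x 2 < x 3"
      using strict_mono_onD[OF x(1), of 1 2] strict_mono_onD[OF x(1), of 2 3] by auto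
    moreover have "p ! t 0 = x 2" "p ! t 1 = x 1"
      using e[rule_format, of 0] e[rule_format, of 1] by simp_all
    moreover have "t 0 < t 1" using strict_mono_onD[OF t(1), of 0 1] by simp
    moreover have "t 1 < n" using t(2) by (simp add: image_subset_iff)
    moreover have "x 3 \<in> {1..n}" using x(2) by fastforce
    then have "x 3 \<in> hat_fixed p" using h p(1) by (simp add: hat_fixed_def)
    ultimately show "\<exists>c\<in>hat_fixed p. \<not> sorted (filter (\<lambda>y. y < c) p)"
      unfolding unsorted by metis
  next
    assume "\<exists>c\<in>hat_fixed p. \<not> sorted (filter (\<lambda>y. y < c) p)"
    then obtain c i j where c: "c \<in> hat_fixed p" and ij: "i < j" "j < n" "p ! j < p ! i" "p ! i < c"
      unfolding unsorted by blast
    \<comment> \<open>The later entry \<open>p ! j\<close> of the inversion is the smaller one and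
      plays 1, while \<open>p ! i\<close> plays 2.\<close>
    define x where "x = (\<lambda>k::nat. if k = 1 then p ! j else if k = 2 then p ! i else c)"
    define t where "t = (\<lambda>k::nat. if k = 0 then i else j)"
    have three: "{1..3} = {1, 2, 3::nat}" by auto
    have "p ! i \<in> {1..n}" "p ! j \<in> {1..n}" "c \<in> {1..n}"
      using ij p c hat_fixed_subset nth_mem by (metis less_trans subsetD)+
    then have "x ` {1..3} \<subseteq> {1..n}" unfolding three by (auto simp: x_def)
    moreover have "strict_mono_on {1..3} x"
      using ij unfolding three by (auto simp: x_def strict_mono_on_def)
    moreover have "strict_mono_on {..<2} t" "t ` {..<2} \<subseteq> {..<n}"
      using ij by (auto simp: t_def strict_mono_on_def)
    moreover have "\<forall>k<2. p ! t k = x ([2, 1] ! k)"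
      by (auto simp: t_def x_def less_2_cases_iff)
    moreover have "hat p (x 3) = x 3" using c by (simp add: x_def hat_fixed_def)
    ultimately show "contains_arrow_pattern p ([2, 1], {(3, 3)})"
      unfolding contains_arrow_pattern_def Let_def letters p(3)
      by (intro exI[of _ x] exI[of _ t]) (simp add: numeral_2_eq_2)
  qed
qed

text \<open>The entries below a smaller fixed point form a subword of those below the largest, so
  sortedness need only be checked for the latter.\<close>

lemma avoiders_21_3_3_eq:
  "avoiders n ([2, 1], {(3, 3)}) =
    {p \<in> permutations_of_set {1..n}. hat_fixed p = {}} \<union> (\<Union>m\<in>{1..n}. words_largest_fixed n m)"
proof (intro set_eqI)
  fix p
  show "p \<in> avoiders n ([2, 1], {(3, 3)}) \<longleftrightarrow>
    p \<in> {p \<in> permutations_of_set {1..n}. hat_fixed p = {}} \<union> (\<Union>m\<in>{1..n}. words_largest_fixed n m)"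
  proof (cases "p \<in> permutations_of_set {1..n}")
    case perm: True
    then have p: "set p = {1..n}" "distinct p" by (auto simp: permutations_of_set_def)
    have av: "p \<in> avoiders n ([2, 1], {(3, 3)}) \<longleftrightarrow>
        (\<forall>c\<in>hat_fixed p. sorted (filter (\<lambda>y. y < c) p))"
      using perm contains_21_3_3_iff[OF perm] by (simp add: avoiders_def)
    show ?thesis
    proof (cases "hat_fixed p = {}")
      case False
      define m where "m = Max (hat_fixed p)"
      have fin: "finite (hat_fixed p)" using hat_fixed_subset finite_subset by blast
      have m: "m \<in> hat_fixed p" "\<forall>x\<in>hat_fixed p. x \<le> m" using fin False by (auto simp: m_def)
      then have "m \<in> {1..n}" using hat_fixed_subset p(1) by blast
      have "(\<forall>c\<in>hat_fixed p. sorted (filter (\<lambda>y. y < c) p)) \<longleftrightarrow> sorted (filter (\<lambda>y. y < m) p)"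
      proof (intro iffI ballI)
        fix c assume s: "sorted (filter (\<lambda>y. y < m) p)" and c: "c \<in> hat_fixed p"
        have "filter (\<lambda>y. y < c) p = filter (\<lambda>y. y < c) (filter (\<lambda>y. y < m) p)"
          using m(2) c by (auto intro!: filter_cong)
        then show "sorted (filter (\<lambda>y. y < c) p)" using sorted_wrt_filter[OF s] by simp
      qed (use m in blast)
      also have "\<dots> \<longleftrightarrow> filter (\<lambda>y. y < m) p = [1..<m]"
      proof
        assume "sorted (filter (\<lambda>y. y < m) p)"
        moreover have "set (filter (\<lambda>y. y < m) p) = set [1..<m]"
          using p(1) \<open>m \<in> {1..n}\<close> by auto
        ultimately show "filter (\<lambda>y. y < m) p = [1..<m]"
          using p(2) by (intro sorted_distinct_set_unique) auto
      qed simp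
      also have "\<dots> \<longleftrightarrow> p \<in> words_largest_fixed n m"
        using perm m by (simp add: words_largest_fixed_def)
      also have "\<dots> \<longleftrightarrow> p \<in> (\<Union>m\<in>{1..n}. words_largest_fixed n m)"
      proof
        assume "p \<in> (\<Union>m\<in>{1..n}. words_largest_fixed n m)"
        then obtain m' where m': "p \<in> words_largest_fixed n m'" by blast
        then have "m' = m" using m by (auto simp: words_largest_fixed_def intro: antisym)
        with m' show "p \<in> words_largest_fixed n m" by simp
      qed (use \<open>m \<in> {1..n}\<close> in blast)
      finally show ?thesis using av False by auto
    qed (use av perm in auto)
  qed (auto simp: avoiders_def words_largest_fixed_def)
qed

theorem theorem3p2:
  fixes n :: nat
  assumes "n \<ge> 1"
  shows "card (avoiders n ([2, 1], {(3, 3)})) =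
    derangement_number n +
    (\<Sum>m = 1..n. \<Sum>k = 0..n - m.
       ((n - m) choose k) * ((m + k - 1) choose (n - m)) * derangement_number k)"
proof -
  let ?E = "{p \<in> permutations_of_set {1..n}. hat_fixed p = {}}"
  have fin: "finite (words_largest_fixed n m)" for m
    by (simp add: words_largest_fixed_def)
  \<comment> \<open>A word has only one largest fixed point.\<close>
  have disj: "words_largest_fixed n m \<inter> words_largest_fixed n m' = {}" if "m \<noteq> m'" for m m'
    using that by (auto simp: words_largest_fixed_def intro: antisym)
  have "card (avoiders n ([2, 1], {(3, 3)})) = card ?E + card (\<Union>m\<in>{1..n}. words_largest_fixed n m)"
    unfolding avoiders_21_3_3_eq using fin
    by (intro card_Un_disjoint) (auto simp: words_largest_fixed_def)
  also have "card ?E = derangement_number n" using card_hat_fixed_empty[of "{1..n}"] by simp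
  also have "card (\<Union>m\<in>{1..n}. words_largest_fixed n m) = (\<Sum>m = 1..n. card (words_largest_fixed n m))"
    using fin disj by (intro card_UN_disjoint) auto
  also have "\<dots> = (\<Sum>m = 1..n. \<Sum>k = 0..n - m.
      ((n - m) choose k) * ((m + k - 1) choose (n - m)) * derangement_number k)"
    by (intro sum.cong refl card_words_largest_fixed) auto
  finally show ?thesis .
qed

end
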